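(* Let $(T_n)_{n\in\mathbb{Z}}$ be the Tribonacci numbers. For every integer $m$ and every non-negative integer $k$, the following identities hold: $$\sum_{j=0}^{k} 2^{-j}\, T_{m-k-4+j} = 2T_{m-k-1} - 2^{-k} T_m,$$ $$2\sum_{j=0}^{k} (-1)^j\, T_{m-4k-1+4j} = (-1)^k T_m + T_{m-4k-4},$$ $$\sum_{j=0}^{k} 2^{j}\, T_{m-3k+1+3j} = 2^{k+1} T_m - T_{m-3k-3}.$$
   Context: The Tribonacci numbers are defined by $T_0=0$, $T_1=T_2=1$ and $T_m=T_{m-1}+T_{m-2}+T_{m-3}$ for $m\ge 3$. They are extended to negative subscripts by $T_{-m}=2T_{-m+3}-T_{-m+4}$ for $m\ge 1$; equivalently, $(T_n)_{n\in\mathbb{Z}}$ is the unique two-sided integer sequence with $T_0=0$, $T_1=T_2=1$ satisfying $T_n=T_{n-1}+T_{n-2}+T_{n-3}$ for all $n\in\mathbb{Z}$ (so e.g. $T_{-1}=0$, $T_{-2}=1$, $T_{-3}=-1$). *)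

theory Defs
  imports Complex_Main
begin

function trib :: "int \<Rightarrow> int" where
  "trib n =
    (if n < 0 then 2 * trib (n + 3) - trib (n + 4)
     else if n = 0 then 0
     else if n \<le> 2 then 1
     else trib (n - 1) + trib (n - 2) + trib (n - 3))"
  by pat_completeness auto
termination
  \<comment> \<open>The offset 4 makes negative arguments larger than the non-negative ones (at most 3)
      that their recursive calls can reach.\<close>
  by (relation "measure (\<lambda>n. if n < 0 then nat (4 - n) else nat n)") auto

declare trib.simps [simp del]

end

theory Submission
  imports Defs
begin

text \<open>
  Subtracting two consecutive instances of the Tribonacci recurrence leaves the four-step
  recurrence \<open>T(n+4) = 2 T(n+3) - T(n)\<close>, with only three terms, on all of \<open>\<int>\<close>.
  Each of the three sums telescopes by it: solve it for one of its terms, and scale so that the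
  other two cancel between consecutive summands. Solving for the lowest term pairs indices
  that differ by 1 with the weight ratio 1/2; solving for the middle term pairs indices that
  differ by 4 with ratio -1; solving for the highest term pairs indices that differ by 3 with
  ratio 2. The identities are proved with the lower end \<open>a\<close> of the index range fixed, so that
  induction on \<open>k\<close> only appends a summand; the theorem takes \<open>a = m - k\<close>, \<open>m - 4 k\<close>
  and \<open>m - 3 k\<close> respectively.
\<close>

text \<open>
  For negative \<open>n\<close> this is the rule by which the sequence is extended to the left. For
  \<open>n \<ge> 0\<close> both \<open>n + 3\<close> and \<open>n + 4\<close> lie in the range of the Tribonacci recurrence, and the
  difference of its two instances is the claim.
\<close>

lemma trib_four_step: "trib (n + 4) = 2 * trib (n + 3) - trib n"
proof (cases "n < 0")
  case True
  then show ?thesis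
    using trib.simps[of n] by simp
next
  case False
  then have "trib (n + 3) = trib (n + 2) + trib (n + 1) + trib n"
    using trib.simps[of "n + 3"] by (simp add: add.commute)
  moreover from False have "trib (n + 4) = trib (n + 3) + trib (n + 2) + trib (n + 1)"
    using trib.simps[of "n + 4"] by (simp add: add.commute)
  ultimately show ?thesis
    by linarith
qed

lemma sum_trib_halving_weights:
  "(\<Sum>j=0..k. 2 powi (- int j) * real_of_int (trib (a - 4 + int j)))
     = 2 * real_of_int (trib (a - 1)) - 2 powi (- int k) * real_of_int (trib (a + int k))"
proof (induction k)
  case 0
  show ?case
    using trib_four_step[of "a - 4"] by simp
next
  case (Suc k)
  have "trib (a - 4 + int (Suc k)) = 2 * trib (a + int k) - trib (a + int (Suc k))"
    using trib_four_step[of "a - 3 + int k"] by (simp add: algebra_simps)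
  then have "2 powi (- int (Suc k)) * real_of_int (trib (a - 4 + int (Suc k)))
      = 2 powi (- int (Suc k)) * (2 * real_of_int (trib (a + int k)) - real_of_int (trib (a + int (Suc k))))"
    by simp
  moreover have "(2::real) powi (- int k) = 2 * 2 powi (- int (Suc k))"
    by (simp add: power_int_minus del: of_nat_Suc)
  ultimately show ?case
    using Suc.IH by (simp add: algebra_simps del: of_nat_Suc)
qed

lemma sum_trib_alternating_weights:
  "2 * (\<Sum>j=0..k. (-1) ^ j * trib (a - 1 + 4 * int j))
     = (-1) ^ k * trib (a + 4 * int k) + trib (a - 4)"
proof (induction k)
  case 0
  show ?case
    using trib_four_step[of "a - 4"] by simp
next
  case (Suc k)
  have "2 * trib (a - 1 + 4 * int (Suc k)) = trib (a + 4 * int (Suc k)) + trib (a + 4 * int k)"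
    using trib_four_step[of "a + 4 * int k"] by (simp add: algebra_simps)
  then have "2 * ((-1) ^ Suc k * trib (a - 1 + 4 * int (Suc k)))
      = (-1) ^ Suc k * (trib (a + 4 * int (Suc k)) + trib (a + 4 * int k))"
    by (metis mult.left_commute)
  then show ?case
    using Suc.IH by (simp add: algebra_simps del: of_nat_Suc)
qed

lemma sum_trib_doubling_weights:
  "(\<Sum>j=0..k. 2 ^ j * trib (a + 1 + 3 * int j))
     = 2 ^ (k + 1) * trib (a + 3 * int k) - trib (a - 3)"
proof (induction k)
  case 0
  show ?case
    using trib_four_step[of "a - 3"] by (simp add: add.commute)
next
  case (Suc k)
  have "trib (a + 1 + 3 * int (Suc k)) = 2 * trib (a + 3 * int (Suc k)) - trib (a + 3 * int k)"
    using trib_four_step[of "a + 3 * int k"] by (simp add: algebra_simps)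
  then have "2 ^ Suc k * trib (a + 1 + 3 * int (Suc k))
      = 2 ^ Suc k * (2 * trib (a + 3 * int (Suc k)) - trib (a + 3 * int k))"
    by simp
  then show ?case
    using Suc.IH by (simp add: algebra_simps del: of_nat_Suc)
qed

theorem theorem1:
  fixes m :: int and k :: nat
  shows "(\<Sum>j=0..k. 2 powi (- int j) * real_of_int (trib (m - int k - 4 + int j)))
           = 2 * real_of_int (trib (m - int k - 1)) - 2 powi (- int k) * real_of_int (trib m)
       \<and> 2 * (\<Sum>j=0..k. (-1) ^ j * trib (m - 4 * int k - 1 + 4 * int j))
           = (-1) ^ k * trib m + trib (m - 4 * int k - 4)
       \<and> (\<Sum>j=0..k. 2 ^ j * trib (m - 3 * int k + 1 + 3 * int j))
           = 2 ^ (k + 1) * trib m - trib (m - 3 * int k - 3)"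
  using sum_trib_halving_weights[of "m - int k" k]
    sum_trib_alternating_weights[of "m - 4 * int k" k]
    sum_trib_doubling_weights[of "m - 3 * int k" k]
  by simp

end
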